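(* Assume (A1)--(A6) (stated in the context), let $\tau>1$ and $\gamma=\max\{|\ln\frac{m_1}{M}|,|\ln\frac{M_1}{m}|\}$, and let the noisy data satisfy $\|y_j-y_j^\delta\|_{L^1}\le\delta_j$ with $\delta_j>0$ for $j=0,\dots,N-1$. Then the sequence $\{x_k^\delta\}$ defined by the loping OS-EM iteration $x_0^\delta=x_0$, $x_{k+1}^\delta=x_k^\delta\,\omega_k$, where $$\omega_k(t)=\int_\Sigma\frac{a_{[k]}(s,t)\,y_{[k]}^\delta(s)}{(\mathcal A_{[k]}x_k^\delta)(s)}\,ds\quad\text{if } f_{[k]}^\delta(x_k^\delta)>\tau\gamma\delta_{[k]},\qquad \omega_k=1\quad\text{otherwise,}$$ satisfies $$d(x^*,x_{k+1}^\delta)\le d(x^*,x_k^\delta),\qquad k\in\mathbb N .$$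
   Context: $\Omega$ and $\Sigma$ are open bounded subsets of $\mathbb R^d$, $d\ge1$, and $N\ge1$ is an integer. For $j=0,\dots,N-1$, $a_j:\Sigma\times\Omega\to\mathbb R$ are measurable kernels, $y_j\in L^1(\Sigma)$ are the exact data, and $(\mathcal A_jx)(s)=\int_\Omega a_j(s,t)x(t)\,dt$ defines $\mathcal A_j:L^1(\Omega)\to L^1(\Sigma)$. The Kullback--Leibler distance of nonnegative $L^1$ functions $v,u$ (both on $\Omega$ or both on $\Sigma$) is $d(v,u)=\int\big[v\ln\frac{v}{u}-v+u\big]\in[0,\infty]$ (with $0\ln 0=0$). Set $f_j^\delta(x)=d(y_j^\delta,\mathcal A_jx)$ and $[k]:=k\bmod N$. $\Delta=\{x\in L^1(\Omega): x\ge0,\ \int_\Omega x(t)\,dt=1\}$, and $x_0\in\Delta$ is a fixed starting element. Assumptions: (A1) $\int_\Sigma a_j(s,t)\,ds=1$ for a.e. $t\in\Omega$, $j=0,\dots,N-1$. (A2) There are positive constants $m,M$ with $m\le a_j(s,t)\le M$ a.e. in $\Sigma\times\Omega$, for all $j$. (A3) $\int_\Sigma y_j(s)\,ds=1$ for all $j$, and there is $M'>0$ with $y_j\le M'$ a.e. in $\Sigma$ for all $j$. (A4) The system $\mathcal A_jx=y_j$, $j=0,\dots,N-1$, has a nonnegative solution $x^*\in L^1(\Omega)$ which does not vanish a.e. in $\Omega$ (i.e. $x^*$ is not a.e. equal to zero), and $d(x^*,x_0)<\infty$. (A5) The noisy data $y_j^\delta\in L^1(\Sigma)$ satisfy $\int_\Sigma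 y_j^\delta(s)\,ds=1$. (A6) There exist $M_1,m_1>0$ such that $m_1\le y_j^\delta\le M_1$ a.e. in $\Sigma$, for all $j$. *)

theory Defs
  imports "HOL-Analysis.Analysis"
begin

text \<open>
  Elements of $L^1(\Omega)$ are represented by functions that are integrable with respect to
  Lebesgue measure on $\Omega$; pointwise relations between them hold almost everywhere.
\<close>

definition L1 :: "(real ^ 'd) set \<Rightarrow> (real ^ 'd \<Rightarrow> real) set" where
  "L1 \<Omega> = {x. integrable (lebesgue_on \<Omega>) x}"

definition Delta :: "(real ^ 'd) set \<Rightarrow> (real ^ 'd \<Rightarrow> real) set" where
  "Delta \<Omega> = {x \<in> L1 \<Omega>. (AE t in lebesgue_on \<Omega>. 0 \<le> x t) \<and>
                            (LINT t|lebesgue_on \<Omega>. x t) = 1}"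

definition int_op ::
    "(real ^ 'd) set \<Rightarrow> (real ^ 'd \<Rightarrow> real ^ 'd \<Rightarrow> real) \<Rightarrow> (real ^ 'd \<Rightarrow> real) \<Rightarrow> real ^ 'd \<Rightarrow> real"
  where "int_op \<Omega> a x s = (LINT t|lebesgue_on \<Omega>. a s t * x t)"

text \<open>
  The Kullback--Leibler integrand, for $v, u \ge 0$. The value for $u = 0 < v$ is given
  explicitly, since \<open>v / 0 = 0\<close> and \<open>ln 0 = 0\<close> would produce \<open>-v\<close> there; the case
  $v = 0$ comes out as $u$, in accordance with $0 \ln 0 = 0$. By \<open>kl_integrand_nonneg\<close> the
  coercion to \<^typ>\<open>ennreal\<close> never truncates.
\<close>

definition kl_integrand :: "real \<Rightarrow> real \<Rightarrow> ennreal" where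
  "kl_integrand v u =
     (if u = 0 \<and> v \<noteq> 0 then \<infinity> else ennreal (v * ln (v / u) - v + u))"

lemma kl_integrand_nonneg:
  fixes v u :: real
  assumes "0 \<le> v" "0 \<le> u" "u = 0 \<longrightarrow> v = 0"
  shows "0 \<le> v * ln (v / u) - v + u"
proof (cases "v = 0")
  case False
  with assms have v: "v > 0" and u: "u > 0" by auto
  have "ln (u / v) \<le> u / v - 1" using u v by (intro ln_le_minus_one) simp
  then have "v * ln (u / v) \<le> u - v" using v by (simp add: field_simps)
  moreover have "ln (v / u) = - ln (u / v)" using u v by (simp add: ln_div)
  ultimately show ?thesis by simp
qed (use assms in simp)

definition KL :: "(real ^ 'd) set \<Rightarrow> (real ^ 'd \<Rightarrow> real) \<Rightarrow> (real ^ 'd \<Rightarrow> real) \<Rightarrow> ennreal" where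
  "KL S v u = (\<integral>\<^sup>+ t. kl_integrand (v t) (u t) \<partial>lebesgue_on S)"

text \<open>
  Loping OS-EM. The threshold \<open>\<theta> j\<close> stands for $\tau\gamma\delta_j$ and is nonnegative in use.
\<close>

definition loping_factor ::
    "(real ^ 'd) set \<Rightarrow> (real ^ 'd) set \<Rightarrow> nat \<Rightarrow> (nat \<Rightarrow> real ^ 'd \<Rightarrow> real ^ 'd \<Rightarrow> real) \<Rightarrow>
     (nat \<Rightarrow> real ^ 'd \<Rightarrow> real) \<Rightarrow> (nat \<Rightarrow> real) \<Rightarrow> nat \<Rightarrow> (real ^ 'd \<Rightarrow> real) \<Rightarrow> real ^ 'd \<Rightarrow> real"
  where "loping_factor \<Omega> \<Sigma> N a yd \<theta> k x t =
    (let j = k mod N in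
       if KL \<Sigma> (yd j) (int_op \<Omega> (a j) x) > ennreal (\<theta> j)
       then LINT s|lebesgue_on \<Sigma>. a j s t * yd j s / int_op \<Omega> (a j) x s
       else 1)"

primrec loping_OSEM ::
    "(real ^ 'd) set \<Rightarrow> (real ^ 'd) set \<Rightarrow> nat \<Rightarrow> (nat \<Rightarrow> real ^ 'd \<Rightarrow> real ^ 'd \<Rightarrow> real) \<Rightarrow>
     (nat \<Rightarrow> real ^ 'd \<Rightarrow> real) \<Rightarrow> (nat \<Rightarrow> real) \<Rightarrow> (real ^ 'd \<Rightarrow> real) \<Rightarrow> nat \<Rightarrow> real ^ 'd \<Rightarrow> real"
  where
    "loping_OSEM \<Omega> \<Sigma> N a yd \<theta> x0 0 = x0"
  | "loping_OSEM \<Omega> \<Sigma> N a yd \<theta> x0 (Suc k) =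
       (\<lambda>t. loping_OSEM \<Omega> \<Sigma> N a yd \<theta> x0 k t *
            loping_factor \<Omega> \<Sigma> N a yd \<theta> k (loping_OSEM \<Omega> \<Sigma> N a yd \<theta> x0 k) t)"

end

theory Submission
  imports Defs
begin

text \<open>
  Write \<open>A\<close> for the operator of the current substep, \<open>z\<close> for its noisy data, \<open>x\<close> for the current
  iterate, \<open>u\<close> for the solution, so that \<open>A u = y\<close>, and \<open>w\<close> for the multiplicative update
  \<open>w(t) = \<integral> a(s,t) z(s) / (A x)(s) ds\<close>. If the substep is skipped, nothing changes;
  if \<open>d(u, x)\<close> is infinite, there is nothing to show. Otherwise both
  \<open>x\<close> and \<open>x w\<close> have integral one, since Fubini gives \<open>\<integral> x w = \<integral> (z / A x) A x = \<integral> z = 1\<close>, and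
  so the distance to the solution changes by exactly
  \<open>d(u, x w) - d(u, x) = - \<integral> u ln w\<close>.

  For almost every \<open>t\<close> the weight \<open>a(\<cdot>,t)\<close> is a probability density, and Jensen's
  inequality for the logarithm yields \<open>ln w(t) \<ge> \<integral> a(s,t) ln (z / A x)(s) ds\<close>. Integrating against
  \<open>u \<ge> 0\<close> and exchanging the integrals once more,
  \<open>\<integral> u ln w \<ge> \<integral> y ln (z / A x) = d(z, A x) + \<integral> (y - z) ln (z / A x)\<close>.
  The bounds on kernel and data confine \<open>z / A x\<close> to \<open>[m1 / M, M1 / m]\<close>, so the logarithm is at
  most \<open>\<gamma>\<close> in absolute value and the last integral is at least \<open>- \<gamma> \<delta>\<close>. A substep is carried out
  only if \<open>d(z, A x) > \<tau> \<gamma> \<delta> \<ge> \<gamma> \<delta>\<close>, and therefore \<open>\<integral> u ln w > 0\<close>.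

  This argument is carried out in \<open>bounded_markov_kernel\<close> for a jointly measurable kernel on a
  product of two finite measures; its outcome is \<open>kl_em_step_le\<close>. A Lebesgue measurable kernel
  need not be measurable for the product of the two Lebesgue \<open>\<sigma>\<close>-algebras, because the Lebesgue
  measure on a product is the completion of the product measure. It is therefore replaced
  by a Borel representative (\<open>kernel_borel_representative\<close>), which alters operator and update only
  on null sets.
\<close>

section \<open>The Kullback--Leibler integral as a real integral\<close>

text \<open>
  Absolute continuity of \<open>v\<close> with respect to \<open>u\<close> excludes the infinite branch of the integrand,
  so the additivity of the Lebesgue integral becomes available for Kullback--Leibler distances.
\<close>

lemma nn_integral_kl_integrand:
  assumes "AE s in P. 0 \<le> v s" "AE s in P. 0 \<le> u s" "AE s in P. u s = 0 \<longrightarrow> v s = 0"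
    and "integrable P (\<lambda>s. v s * ln (v s / u s) - v s + u s)"
  shows "(\<integral>\<^sup>+ s. kl_integrand (v s) (u s) \<partial>P)
           = ennreal (LINT s|P. v s * ln (v s / u s) - v s + u s)"
proof -
  have "AE s in P. 0 \<le> v s * ln (v s / u s) - v s + u s"
    using assms(1-3) by eventually_elim (rule kl_integrand_nonneg; simp)
  then have "(\<integral>\<^sup>+ s. ennreal (v s * ln (v s / u s) - v s + u s) \<partial>P)
           = ennreal (LINT s|P. v s * ln (v s / u s) - v s + u s)"
    using assms(4) by (intro nn_integral_eq_integral)
  moreover have "(\<integral>\<^sup>+ s. kl_integrand (v s) (u s) \<partial>P)
      = (\<integral>\<^sup>+ s. ennreal (v s * ln (v s / u s) - v s + u s) \<partial>P)"
    by (rule nn_integral_cong_AE, use assms(3) in eventually_elim) (auto simp: kl_integrand_def)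
  ultimately show ?thesis by simp
qed

text \<open>
  The converse of \<open>nn_integral_kl_integrand\<close>. Integrability comes from the sign and the finite
  integral of the whole integrand and cannot be obtained term by term: neither \<open>v ln v\<close> nor
  \<open>v ln u\<close> need be integrable.
\<close>

lemma kl_finite_imp:
  assumes meas: "v \<in> borel_measurable P" "u \<in> borel_measurable P"
    and nonneg: "AE s in P. 0 \<le> v s" "AE s in P. 0 \<le> u s"
    and fin: "(\<integral>\<^sup>+ s. kl_integrand (v s) (u s) \<partial>P) < \<infinity>"
  shows "AE s in P. u s = 0 \<longrightarrow> v s = 0"
    and "integrable P (\<lambda>s. v s * ln (v s / u s) - v s + u s)"
proof -
  note meas[measurable]
  have "(\<lambda>s. kl_integrand (v s) (u s)) \<in> borel_measurable P"
    unfolding kl_integrand_def by measurable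
  then have "AE s in P. kl_integrand (v s) (u s) \<noteq> \<infinity>"
    using fin by (intro nn_integral_PInf_AE) auto
  then show dom: "AE s in P. u s = 0 \<longrightarrow> v s = 0"
    by eventually_elim (simp add: kl_integrand_def split: if_splits)
  have "AE s in P. 0 \<le> v s * ln (v s / u s) - v s + u s"
    using nonneg dom by eventually_elim (rule kl_integrand_nonneg; simp)
  moreover have "(\<integral>\<^sup>+ s. kl_integrand (v s) (u s) \<partial>P)
      = (\<integral>\<^sup>+ s. ennreal (v s * ln (v s / u s) - v s + u s) \<partial>P)"
    by (rule nn_integral_cong_AE, use dom in eventually_elim) (auto simp: kl_integrand_def)
  ultimately show "integrable P (\<lambda>s. v s * ln (v s / u s) - v s + u s)"
    using fin by (intro integrableI_nonneg) auto
qed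

section \<open>Expectation-maximization steps for bounded Markov kernels\<close>

definition prob_density :: "'a measure \<Rightarrow> ('a \<Rightarrow> real) \<Rightarrow> bool" where
  "prob_density P x \<longleftrightarrow>
     integrable P x \<and> (AE t in P. 0 \<le> x t) \<and> (LINT t|P. x t) = 1"

lemma abs_ln_between:
  fixes r lo hi :: real
  assumes "0 < lo" "lo \<le> r" "r \<le> hi"
  shows "\<bar>ln r\<bar> \<le> max \<bar>ln lo\<bar> \<bar>ln hi\<bar>"
proof -
  have "ln lo \<le> ln r" "ln r \<le> ln hi" using assms by simp_all
  then show ?thesis by linarith
qed

text \<open>
  The bounds on the kernel are imposed everywhere rather than almost everywhere; truncating
  a representative achieves this, and each section of the kernel is then bounded without an
  exceptional set.
\<close>

locale bounded_markov_kernel =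
  P: finite_measure P + Q: finite_measure Q
  for P :: "'s measure" and Q :: "'t measure" +
  fixes b :: "'s \<Rightarrow> 't \<Rightarrow> real" and m M :: real
  assumes b_meas: "(\<lambda>(s, t). b s t) \<in> borel_measurable (P \<Otimes>\<^sub>M Q)"
    and m_pos: "0 < m"
    and b_bounds: "\<And>s t. m \<le> b s t" "\<And>s t. b s t \<le> M"
    and b_mass: "AE t in Q. (LINT s|P. b s t) = 1"
begin

sublocale pair_sigma_finite P Q ..

definition forward :: "('t \<Rightarrow> real) \<Rightarrow> 's \<Rightarrow> real" where
  "forward x s = (LINT t|Q. b s t * x t)"

definition em_factor :: "('s \<Rightarrow> real) \<Rightarrow> ('t \<Rightarrow> real) \<Rightarrow> 't \<Rightarrow> real" where
  "em_factor z x t = (LINT s|P. b s t * (z s / forward x s))"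

lemma b_measurable [measurable (raw)]:
  assumes "f \<in> L \<rightarrow>\<^sub>M P" "g \<in> L \<rightarrow>\<^sub>M Q"
  shows "(\<lambda>l. b (f l) (g l)) \<in> borel_measurable L"
  using measurable_compose[OF measurable_Pair[OF assms] b_meas] by simp

lemma M_pos: "0 < M"
  using m_pos b_bounds[of undefined undefined] by linarith

lemma abs_b_le: "\<bar>b s t\<bar> \<le> M"
  using b_bounds[of s t] m_pos by linarith

lemma forward_measurable [measurable]:
  assumes [measurable]: "x \<in> borel_measurable Q"
  shows "forward x \<in> borel_measurable P"
  unfolding forward_def by measurable

lemma em_factor_measurable [measurable]:
  assumes [measurable]: "x \<in> borel_measurable Q" "z \<in> borel_measurable P"
  shows "em_factor z x \<in> borel_measurable Q"
  unfolding em_factor_def by measurable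

lemma integrable_b_right: "integrable Q x \<Longrightarrow> s \<in> space P \<Longrightarrow> integrable Q (\<lambda>t. b s t * x t)"
  by (rule Bochner_Integration.integrable_bound[of Q "\<lambda>t. M * x t"])
    (use abs_b_le M_pos in \<open>auto simp: abs_mult intro!: mult_right_mono\<close>)

lemma integrable_b_left: "integrable P h \<Longrightarrow> t \<in> space Q \<Longrightarrow> integrable P (\<lambda>s. b s t * h s)"
  by (rule Bochner_Integration.integrable_bound[of P "\<lambda>s. M * h s"])
    (use abs_b_le M_pos in \<open>auto simp: abs_mult intro!: mult_right_mono\<close>)

text \<open>
  The tensor product of integrable functions is integrable, and a bounded kernel preserves that;
  every exchange of integrals below rests on this bound.
\<close>

lemma integrable_b_prod:
  assumes h: "integrable P h" and x: "integrable Q x"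
  shows "integrable (P \<Otimes>\<^sub>M Q) (\<lambda>(s, t). b s t * (h s * x t))"
proof -
  have [measurable]: "h \<in> borel_measurable P" "x \<in> borel_measurable Q" using h x by auto
  have "integrable (P \<Otimes>\<^sub>M Q) (\<lambda>(s, t). h s * x t)"
    by (rule Fubini_integrable) (use h x in \<open>auto simp: abs_mult\<close>)
  then have "integrable (P \<Otimes>\<^sub>M Q) (\<lambda>p. M * (case p of (s, t) \<Rightarrow> h s * x t))"
    by simp
  then show ?thesis
    by (rule Bochner_Integration.integrable_bound)
      (use abs_b_le M_pos in \<open>auto simp: abs_mult intro!: AE_I2 mult_right_mono\<close>)
qed

text \<open>
  The averaging \<open>h \<mapsto> \<integral> b(s, \<cdot>) h(s) ds\<close> is the adjoint of \<open>forward\<close>; \<open>em_factor\<close> is the adjoint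
  applied to the ratio of data and prediction.
\<close>

lemma forward_duality:
  assumes h: "integrable P h" and x: "integrable Q x"
  shows "integrable P (\<lambda>s. h s * forward x s)"
    and "integrable Q (\<lambda>t. x t * (LINT s|P. b s t * h s))"
    and "(LINT s|P. h s * forward x s) = (LINT t|Q. x t * (LINT s|P. b s t * h s))"
proof -
  note int = integrable_b_prod[OF assms]
  have 1: "(LINT t|Q. b s t * (h s * x t)) = h s * forward x s" for s
    by (simp add: forward_def mult.left_commute flip: integral_mult_right_zero)
  have 2: "(LINT s|P. b s t * (h s * x t)) = x t * (LINT s|P. b s t * h s)" for t
    by (simp add: mult_ac flip: integral_mult_right_zero)
  show "integrable P (\<lambda>s. h s * forward x s)"
    using integrable_fst[OF int] by (simp add: 1)
  show "integrable Q (\<lambda>t. x t * (LINT s|P. b s t * h s))"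
    using integrable_snd[OF int] by (simp add: 2)
  show "(LINT s|P. h s * forward x s) = (LINT t|Q. x t * (LINT s|P. b s t * h s))"
    using Fubini_integral[OF int] by (simp add: 1 2)
qed

lemma
  assumes x: "integrable Q x"
  shows integrable_forward: "integrable P (forward x)"
    and integral_forward: "(LINT s|P. forward x s) = (LINT t|Q. x t)"
proof -
  note d = forward_duality[of "\<lambda>_. 1", OF _ x, simplified]
  show "integrable P (forward x)" using d(1) by simp
  have "(LINT s|P. forward x s) = (LINT t|Q. x t * (LINT s|P. b s t))" using d(3) by simp
  also have "\<dots> = (LINT t|Q. x t)"
    using b_mass x by (intro integral_cong_AE) (auto elim: eventually_mono)
  finally show "(LINT s|P. forward x s) = (LINT t|Q. x t)" .
qed

lemma forward_bounds:
  assumes x: "prob_density Q x" and s: "s \<in> space P"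
  shows "m \<le> forward x s" "forward x s \<le> M"
proof -
  have i: "integrable Q x" "AE t in Q. 0 \<le> x t" and x1: "(LINT t|Q. x t) = 1"
    using x by (auto simp: prob_density_def)
  have "(LINT t|Q. m * x t) \<le> forward x s"
    unfolding forward_def using i(2) b_bounds
    by (intro integral_mono_AE integrable_b_right i s integrable_mult_right)
       (auto elim!: eventually_mono intro!: mult_right_mono)
  then show "m \<le> forward x s" using x1 by simp
  have "forward x s \<le> (LINT t|Q. M * x t)"
    unfolding forward_def using i(2) b_bounds
    by (intro integral_mono_AE integrable_b_right i s integrable_mult_right)
       (auto elim!: eventually_mono intro!: mult_right_mono)
  then show "forward x s \<le> M" using x1 by simp
qed

lemma forward_prob_density:
  "prob_density Q x \<Longrightarrow> prob_density P (forward x)"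
  using integrable_forward[of x] integral_forward[of x] forward_bounds(1)[of x] m_pos
  by (auto simp: prob_density_def intro!: AE_I2 order.trans[OF less_imp_le[OF m_pos]])

lemma ratio_bounds:
  assumes x: "prob_density Q x"
    and z: "AE s in P. m1 \<le> z s \<and> z s \<le> M1" and m1: "0 < m1"
  shows "AE s in P. m1 / M \<le> z s / forward x s \<and> z s / forward x s \<le> M1 / m"
  using z AE_space
proof eventually_elim
  case (elim s)
  note f = forward_bounds[OF x elim(2)]
  then show ?case using elim m1 m_pos M_pos by (auto intro!: frac_le)
qed

lemma kernel_average_bounds:
  assumes h: "integrable P h" and c: "AE s in P. c \<le> h s \<and> h s \<le> C"
  shows "AE t in Q. c \<le> (LINT s|P. b s t * h s) \<and> (LINT s|P. b s t * h s) \<le> C"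
  using b_mass AE_space
proof eventually_elim
  case (elim t)
  have b0: "0 \<le> b s t" for s using b_bounds(1)[of s t] m_pos by linarith
  have ib: "integrable P (\<lambda>s. b s t)" using integrable_b_left[of "\<lambda>_. 1", OF _ elim(2)] by simp
  have "(LINT s|P. b s t * c) \<le> (LINT s|P. b s t * h s)"
    using c b0
    by (intro integral_mono_AE integrable_b_left[OF h elim(2)] integrable_mult_left ib)
      (auto elim: eventually_mono intro: mult_left_mono)
  moreover have "(LINT s|P. b s t * h s) \<le> (LINT s|P. b s t * C)"
    using c b0
    by (intro integral_mono_AE integrable_b_left[OF h elim(2)] integrable_mult_left ib)
      (auto elim: eventually_mono intro: mult_left_mono)
  ultimately show ?case using elim(1) by simp
qed

text \<open>
  Jensen's inequality for the probability weights \<open>b(\<cdot>, t)\<close>, by integrating the tangent line of the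
  logarithm at the average \<open>w\<close>, that is \<open>ln h \<le> ln w - 1 + h / w\<close>.
\<close>

lemma kernel_average_ln_le:
  assumes h: "integrable P h" and lh: "integrable P (\<lambda>s. ln (h s))"
    and c: "0 < c" "AE s in P. c \<le> h s \<and> h s \<le> C"
  shows "AE t in Q. (LINT s|P. b s t * ln (h s)) \<le> ln (LINT s|P. b s t * h s)"
  using kernel_average_bounds[OF h c(2)] b_mass AE_space
proof eventually_elim
  case (elim t)
  define w where "w = (LINT s|P. b s t * h s)"
  have w: "0 < w" using elim(1) c(1) by (auto simp: w_def)
  have b0: "0 \<le> b s t" for s using b_bounds(1)[of s t] m_pos by linarith
  have ib: "integrable P (\<lambda>s. b s t)" using integrable_b_left[of "\<lambda>_. 1", OF _ elim(3)] by simp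
  note ih = integrable_b_left[OF h elim(3)]
  have "(LINT s|P. b s t * ln (h s)) \<le> (LINT s|P. b s t * (ln w - 1) + b s t * h s / w)"
  proof (intro integral_mono_AE integrable_b_left[OF lh elim(3)]
      Bochner_Integration.integrable_add integrable_mult_left integrable_divide_zero ib ih)
    show "AE s in P. b s t * ln (h s) \<le> b s t * (ln w - 1) + b s t * h s / w"
      using c(2)
    proof eventually_elim
      case (elim s)
      have "ln (h s / w) \<le> h s / w - 1" using elim c w by (intro ln_le_minus_one) auto
      then have "ln (h s) \<le> ln w - 1 + h s / w" using elim c w by (simp add: ln_div)
      then have "b s t * ln (h s) \<le> b s t * (ln w - 1 + h s / w)" by (rule mult_left_mono[OF _ b0])
      then show ?case by (simp add: algebra_simps)
    qed
  qed
  also have "\<dots> = (LINT s|P. b s t) * (ln w - 1) + w / w"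
    using ib ih by (subst Bochner_Integration.integral_add) (auto simp: w_def)
  also have "\<dots> = ln w" using w elim(2) by simp
  finally show ?case by (simp add: w_def)
qed

context
  fixes x :: "'t \<Rightarrow> real" and z :: "'s \<Rightarrow> real" and m1 M1 :: real
  assumes x: "prob_density Q x" and z: "prob_density P z"
    and m1: "0 < m1" and z_bounds: "AE s in P. m1 \<le> z s \<and> z s \<le> M1"
begin

lemma xz_measurable [measurable]: "x \<in> borel_measurable Q" "z \<in> borel_measurable P"
  using x z by (auto simp: prob_density_def)

lemma integrable_ratio: "integrable P (\<lambda>s. z s / forward x s)"
proof (rule Bochner_Integration.integrable_bound)
  show "integrable P (\<lambda>_. M1 / m)" by simp
  show "AE s in P. norm (z s / forward x s) \<le> norm (M1 / m)"
    using ratio_bounds[OF x z_bounds m1]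
  proof eventually_elim
    case (elim s)
    have "0 < m1 / M" using m1 M_pos by simp
    then have "\<bar>z s / forward x s\<bar> \<le> \<bar>M1 / m\<bar>" using elim by linarith
    then show ?case by (simp only: real_norm_def)
  qed
qed measurable

lemma abs_ln_ratio_le:
  "AE s in P. \<bar>ln (z s / forward x s)\<bar> \<le> max \<bar>ln (m1 / M)\<bar> \<bar>ln (M1 / m)\<bar>"
  using ratio_bounds[OF x z_bounds m1]
  by eventually_elim (use m1 M_pos in \<open>auto intro!: abs_ln_between\<close>)

lemma integrable_ln_ratio_mult:
  assumes "integrable P f"
  shows "integrable P (\<lambda>s. f s * ln (z s / forward x s))"
proof (rule Bochner_Integration.integrable_bound)
  let ?g = "max \<bar>ln (m1 / M)\<bar> \<bar>ln (M1 / m)\<bar>"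
  show "integrable P (\<lambda>s. f s * ?g)" using assms by simp
  show "(\<lambda>s. f s * ln (z s / forward x s)) \<in> borel_measurable P" using assms by measurable
  show "AE s in P. norm (f s * ln (z s / forward x s)) \<le> norm (f s * ?g)"
    using abs_ln_ratio_le by eventually_elim (auto simp: abs_mult intro!: mult_left_mono)
qed

lemma em_factor_bounds:
  "AE t in Q. m1 / M \<le> em_factor z x t \<and> em_factor z x t \<le> M1 / m"
  unfolding em_factor_def
  by (rule kernel_average_bounds[OF integrable_ratio ratio_bounds[OF x z_bounds m1]])

text \<open>
  By duality the mass of the updated density is \<open>\<integral> (z / A x) A x\<close>, in which the prediction
  cancels and the mass of the data remains.
\<close>

lemma em_step_prob_density: "prob_density Q (\<lambda>t. x t * em_factor z x t)"
proof -
  have ix: "integrable Q x" "AE t in Q. 0 \<le> x t" using x by (auto simp: prob_density_def)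
  note d = forward_duality[OF integrable_ratio ix(1), folded em_factor_def]
  have "(LINT t|Q. x t * em_factor z x t) = (LINT s|P. z s / forward x s * forward x s)"
    using d(3) by simp
  also have "\<dots> = (LINT s|P. z s)"
    using forward_bounds(1)[OF x] m_pos by (intro Bochner_Integration.integral_cong) force+
  also have "\<dots> = 1" using z by (simp add: prob_density_def)
  finally have "(LINT t|Q. x t * em_factor z x t) = 1" .
  moreover have "AE t in Q. 0 \<le> x t * em_factor z x t"
    using ix(2) em_factor_bounds
  proof eventually_elim
    case (elim t)
    have "0 < m1 / M" using m1 M_pos by simp
    then show ?case using elim by (intro mult_nonneg_nonneg) linarith+
  qed
  ultimately show ?thesis using d(2) by (simp add: prob_density_def)
qed

lemma kl_data_eq:
  "(\<integral>\<^sup>+ s. kl_integrand (z s) (forward x s) \<partial>P)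
     = ennreal (LINT s|P. z s * ln (z s / forward x s))"
proof -
  note fx = forward_prob_density[OF x]
  have i: "integrable P z" "integrable P (forward x)"
    "(LINT s|P. z s) = 1" "(LINT s|P. forward x s) = 1"
    using z fx by (auto simp: prob_density_def)
  note il = integrable_ln_ratio_mult[OF i(1)]
  have "(\<integral>\<^sup>+ s. kl_integrand (z s) (forward x s) \<partial>P)
      = ennreal (LINT s|P. z s * ln (z s / forward x s) - z s + forward x s)"
  proof (rule nn_integral_kl_integrand)
    show "AE s in P. 0 \<le> z s" "AE s in P. 0 \<le> forward x s"
      using z fx by (auto simp: prob_density_def)
    show "AE s in P. forward x s = 0 \<longrightarrow> z s = 0"
      using forward_bounds(1)[OF x] m_pos by (intro AE_I2) force
  qed (use i il in auto)
  also have "(LINT s|P. z s * ln (z s / forward x s) - z s + forward x s)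
      = (LINT s|P. z s * ln (z s / forward x s))"
    using i il by simp
  finally show ?thesis .
qed

text \<open>
  Jensen's inequality and duality bound the gain from below by \<open>\<integral> (A u) ln (z / A x)\<close>. The
  distance \<open>d(z, A x)\<close> has \<open>z\<close> in place of \<open>A u\<close>, and the bound on the logarithm of the
  ratio turns this substitution into an error of at most \<open>\<gamma> \<delta>\<close>.
\<close>

lemma integral_ln_em_factor_ge:
  assumes u: "integrable Q u" "AE t in Q. 0 \<le> u t"
    and dist: "(LINT s|P. \<bar>forward u s - z s\<bar>) \<le> \<delta>"
  shows "integrable Q (\<lambda>t. u t * ln (em_factor z x t))"
    and "(LINT s|P. z s * ln (z s / forward x s)) - max \<bar>ln (m1 / M)\<bar> \<bar>ln (M1 / m)\<bar> * \<delta>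
           \<le> (LINT t|Q. u t * ln (em_factor z x t))"
proof -
  define \<gamma> where "\<gamma> = max \<bar>ln (m1 / M)\<bar> \<bar>ln (M1 / m)\<bar>"
  define L where "L s = ln (z s / forward x s)" for s
  have L_le: "AE s in P. \<bar>L s\<bar> \<le> \<gamma>" using abs_ln_ratio_le by (simp add: L_def \<gamma>_def)
  have \<gamma>0: "0 \<le> \<gamma>" by (simp add: \<gamma>_def)
  have iz: "integrable P z" using z by (simp add: prob_density_def)
  note fu = integrable_forward[OF u(1)]
  have iL: "integrable P L" using integrable_ln_ratio_mult[of "\<lambda>_. 1"] by (simp add: L_def[abs_def])
  have ifL: "integrable P (\<lambda>s. f s * L s)" if "integrable P f" for f
    using integrable_ln_ratio_mult[OF that] by (simp add: L_def)
  have iD: "integrable P (\<lambda>s. forward u s - z s)" using fu iz by simp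
  have [measurable]: "u \<in> borel_measurable Q" using u by auto
  show iW: "integrable Q (\<lambda>t. u t * ln (em_factor z x t))"
  proof (rule Bochner_Integration.integrable_bound)
    show "integrable Q (\<lambda>t. u t * \<gamma>)" using u by simp
    show "AE t in Q. norm (u t * ln (em_factor z x t)) \<le> norm (u t * \<gamma>)"
      using em_factor_bounds
    proof eventually_elim
      case (elim t)
      then have "\<bar>ln (em_factor z x t)\<bar> \<le> \<gamma>"
        unfolding \<gamma>_def using m1 M_pos by (intro abs_ln_between) auto
      then show ?case using \<gamma>0 by (auto simp: abs_mult intro!: mult_left_mono)
    qed
  qed measurable
  have "- (\<gamma> * \<delta>) \<le> - (LINT s|P. \<gamma> * \<bar>forward u s - z s\<bar>)"
    using mult_left_mono[OF dist \<gamma>0] by simp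
  also have "\<dots> = (LINT s|P. - (\<gamma> * \<bar>forward u s - z s\<bar>))" by simp
  also have "\<dots> \<le> (LINT s|P. (forward u s - z s) * L s)"
  proof (rule integral_mono_AE)
    show "AE s in P. - (\<gamma> * \<bar>forward u s - z s\<bar>) \<le> (forward u s - z s) * L s"
      using L_le
    proof eventually_elim
      case (elim s)
      have "\<bar>(forward u s - z s) * L s\<bar> \<le> \<gamma> * \<bar>forward u s - z s\<bar>"
        using mult_left_mono[OF elim abs_ge_zero, of "forward u s - z s"]
        by (simp add: abs_mult mult.commute)
      then show ?case by linarith
    qed
  qed (use iD ifL[OF iD] in auto)
  also have "\<dots> = (LINT s|P. L s * forward u s) - (LINT s|P. z s * L s)"
    using ifL[OF fu] ifL[OF iz]
    by (subst Bochner_Integration.integral_diff[symmetric]) (auto simp: algebra_simps)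
  also have "(LINT s|P. L s * forward u s) = (LINT t|Q. u t * (LINT s|P. b s t * L s))"
    by (rule forward_duality(3)[OF iL u(1)])
  also have "\<dots> \<le> (LINT t|Q. u t * ln (em_factor z x t))"
  proof (rule integral_mono_AE[OF forward_duality(2)[OF iL u(1)] iW])
    have "AE t in Q. (LINT s|P. b s t * L s) \<le> ln (em_factor z x t)"
      unfolding em_factor_def L_def
      using ratio_bounds[OF x z_bounds m1] iL m1 M_pos
      by (intro kernel_average_ln_le[where c = "m1 / M"] integrable_ratio) (auto simp: L_def[abs_def])
    then show "AE t in Q. u t * (LINT s|P. b s t * L s) \<le> u t * ln (em_factor z x t)"
      using u(2) by eventually_elim (auto intro: mult_left_mono)
  qed
  finally show "(LINT s|P. z s * ln (z s / forward x s)) - max \<bar>ln (m1 / M)\<bar> \<bar>ln (M1 / m)\<bar> * \<delta>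
           \<le> (LINT t|Q. u t * ln (em_factor z x t))"
    by (simp add: L_def \<gamma>_def)
qed

text \<open>
  Both iterates have mass one, so the linear terms cancel and a finite distance decreases by exactly
  \<open>\<integral> u ln w\<close>. A discrepancy above \<open>\<gamma> \<delta>\<close> makes this gain positive.
\<close>

theorem kl_em_step_le:
  assumes u: "integrable Q u" "AE t in Q. 0 \<le> u t"
    and dist: "(LINT s|P. \<bar>forward u s - z s\<bar>) \<le> \<delta>"
    and discr: "ennreal (max \<bar>ln (m1 / M)\<bar> \<bar>ln (M1 / m)\<bar> * \<delta>)
                  < (\<integral>\<^sup>+ s. kl_integrand (z s) (forward x s) \<partial>P)"
  shows "(\<integral>\<^sup>+ t. kl_integrand (u t) (x t * em_factor z x t) \<partial>Q)
           \<le> (\<integral>\<^sup>+ t. kl_integrand (u t) (x t) \<partial>Q)"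
proof (cases "(\<integral>\<^sup>+ t. kl_integrand (u t) (x t) \<partial>Q) < \<infinity>")
  case False
  then show ?thesis by (metis infinity_ennreal_def top.not_eq_extremum top_greatest)
next
  case True
  define W where "W = em_factor z x"
  have [measurable]: "u \<in> borel_measurable Q" using u by auto
  have xd: "integrable Q x" "AE t in Q. 0 \<le> x t" "(LINT t|Q. x t) = 1"
    using x by (auto simp: prob_density_def)
  have xWd: "integrable Q (\<lambda>t. x t * W t)" "AE t in Q. 0 \<le> x t * W t" "(LINT t|Q. x t * W t) = 1"
    using em_step_prob_density by (auto simp: prob_density_def W_def)
  note fin = kl_finite_imp[OF _ _ u(2) xd(2) True]
  have dom: "AE t in Q. x t = 0 \<longrightarrow> u t = 0" by (rule fin) measurable
  have ikl: "integrable Q (\<lambda>t. u t * ln (u t / x t) - u t + x t)" by (rule fin) measurable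
  have W_pos: "AE t in Q. 0 < W t"
    using em_factor_bounds
  proof eventually_elim
    case (elim t)
    have "0 < m1 / M" using m1 M_pos by simp
    then show ?case using elim by (simp add: W_def)
  qed
  note ge = integral_ln_em_factor_ge[OF u dist, folded W_def]
  have gain: "0 \<le> (LINT t|Q. u t * ln (W t))"
  proof -
    have "max \<bar>ln (m1 / M)\<bar> \<bar>ln (M1 / m)\<bar> * \<delta> < (LINT s|P. z s * ln (z s / forward x s))"
      by (rule contrapos_pp[OF discr[unfolded kl_data_eq]]) (simp add: not_less ennreal_leI)
    then show ?thesis using ge(2) by linarith
  qed
  have split: "AE t in Q. u t * ln (u t / (x t * W t)) - u t + x t * W t
      = (u t * ln (u t / x t) - u t + x t) - u t * ln (W t) + (x t * W t - x t)"
    using dom W_pos u(2) xd(2)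
  proof eventually_elim
    case (elim t)
    show ?case
    proof (cases "u t = 0")
      case False
      \<comment> \<open>Here \<open>x t \<noteq> 0\<close> by absolute continuity, so the logarithm of the quotient splits.\<close>
      with elim have "0 < u t" "0 < x t" "0 < W t" by auto
      then have "ln (u t / (x t * W t)) = ln (u t / x t) - ln (W t)"
        by (simp add: ln_div ln_mult)
      then have "u t * ln (u t / (x t * W t)) = u t * ln (u t / x t) - u t * ln (W t)"
        by (simp only: right_diff_distrib)
      then show ?thesis by linarith
    qed simp
  qed
  have irhs: "integrable Q (\<lambda>t. (u t * ln (u t / x t) - u t + x t) - u t * ln (W t)
      + (x t * W t - x t))"
    by (intro Bochner_Integration.integrable_add Bochner_Integration.integrable_diff ikl ge(1) xWd xd)
  have [measurable]: "W \<in> borel_measurable Q" by (simp add: W_def)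
  have i2: "integrable Q (\<lambda>t. u t * ln (u t / (x t * W t)) - u t + x t * W t)"
    by (rule integrable_cong_AE_imp[OF irhs]) (measurable, use split in \<open>auto elim: eventually_mono\<close>)
  have "(\<integral>\<^sup>+ t. kl_integrand (u t) (x t * W t) \<partial>Q)
      = ennreal (LINT t|Q. u t * ln (u t / (x t * W t)) - u t + x t * W t)"
  proof (rule nn_integral_kl_integrand[OF u(2) xWd(2) _ i2])
    show "AE t in Q. x t * W t = 0 \<longrightarrow> u t = 0"
      using dom W_pos by eventually_elim auto
  qed
  also have "(LINT t|Q. u t * ln (u t / (x t * W t)) - u t + x t * W t)
      = (LINT t|Q. (u t * ln (u t / x t) - u t + x t) - u t * ln (W t) + (x t * W t - x t))"
    using split by (intro integral_cong_AE borel_measurable_integrable[OF i2]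
        borel_measurable_integrable[OF irhs])
  also have "\<dots> = (LINT t|Q. u t * ln (u t / x t) - u t + x t) - (LINT t|Q. u t * ln (W t))"
    apply (subst Bochner_Integration.integral_add)
    subgoal by (intro Bochner_Integration.integrable_diff ikl ge(1))
    subgoal by (intro Bochner_Integration.integrable_diff xWd xd)
    apply (subst Bochner_Integration.integral_diff[OF ikl ge(1)])
    apply (subst Bochner_Integration.integral_diff[OF xWd(1) xd(1)])
    by (simp add: xd xWd)
  also have "ennreal \<dots> \<le> ennreal (LINT t|Q. u t * ln (u t / x t) - u t + x t)"
    using gain by (intro ennreal_leI) simp
  also have "\<dots> = (\<integral>\<^sup>+ t. kl_integrand (u t) (x t) \<partial>Q)"
    by (rule nn_integral_kl_integrand[OF u(2) xd(2) dom ikl, symmetric])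
  finally show ?thesis by (simp add: W_def)
qed

end

end

section \<open>Lebesgue measurable kernels\<close>

text \<open>
  A Lebesgue null set in the product lies in a Borel null set, to which Fubini's theorem for
  the product of the two Borel measures applies.
\<close>

lemma AE_lebesgue_on_Times:
  fixes S :: "'a::euclidean_space set" and T :: "'b::euclidean_space set"
  assumes "open S" "open T" and R: "AE p in lebesgue_on (S \<times> T). R p"
  shows "AE s in lebesgue_on S. AE t in lebesgue_on T. R (s, t)"
    and "AE t in lebesgue_on T. AE s in lebesgue_on S. R (s, t)"
proof -
  have sets: "S \<in> sets lebesgue" "T \<in> sets lebesgue" "S \<times> T \<in> sets lebesgue"
    using assms(1,2) open_Times[OF assms(1,2)] by (auto intro!: sets_completionI_sets)
  have "AE p in lebesgue. p \<in> S \<times> T \<longrightarrow> R p"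
    using R sets(3) by (simp add: AE_restrict_space_iff)
  then have "AE p in lborel. p \<in> S \<times> T \<longrightarrow> R p"
    by (simp add: AE_completion_iff)
  then obtain Z where "\<And>p. p \<in> space lborel - Z \<Longrightarrow> p \<in> S \<times> T \<longrightarrow> R p"
    and Z: "Z \<in> null_sets lborel"
    by (rule AE_E3) blast
  then have outside: "R (s, t)" if "(s, t) \<notin> Z" "s \<in> S" "t \<in> T" for s t
    using that by simp
  have "AE p in lborel \<Otimes>\<^sub>M lborel. p \<notin> Z"
    unfolding lborel_prod using Z by (rule AE_not_in)
  then have 1: "AE s in lborel. AE t in lborel. (s, t) \<notin> Z"
    by (rule lborel_pair.AE_pair)
  have "{p \<in> space (lborel \<Otimes>\<^sub>M lborel). p \<notin> Z} \<in> sets (lborel \<Otimes>\<^sub>M lborel)"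
    using Z unfolding lborel_prod by auto
  then have 2: "AE t in lborel. AE s in lborel. (s, t) \<notin> Z"
    using lborel_pair.AE_commute[of "\<lambda>s t. (s, t) \<notin> Z"] 1 by simp
  have "AE s in lebesgue. AE t in lebesgue. (s, t) \<notin> Z"
    using 1 by (simp only: AE_completion_iff)
  then have "AE s in lebesgue. s \<in> S \<longrightarrow> (AE t in lebesgue. t \<in> T \<longrightarrow> R (s, t))"
    by eventually_elim (intro impI, elim eventually_mono, blast intro: outside)
  then show "AE s in lebesgue_on S. AE t in lebesgue_on T. R (s, t)"
    using sets(1,2) by (simp add: AE_restrict_space_iff)
  have "AE t in lebesgue. AE s in lebesgue. (s, t) \<notin> Z"
    using 2 by (simp only: AE_completion_iff)
  then have "AE t in lebesgue. t \<in> T \<longrightarrow> (AE s in lebesgue. s \<in> S \<longrightarrow> R (s, t))"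
    by eventually_elim (intro impI, elim eventually_mono, blast intro: outside)
  then show "AE t in lebesgue_on T. AE s in lebesgue_on S. R (s, t)"
    using sets(1,2) by (simp add: AE_restrict_space_iff)
qed

text \<open>
  By completeness of Lebesgue measure, measurability passes from one function to the other. The
  integrals in the iteration can thus be compared with those of a representative of the kernel
  before the measurability of their integrands is known.
\<close>

lemma
  fixes f g :: "'a::euclidean_space \<Rightarrow> real"
  assumes S: "S \<in> sets lebesgue" and ae: "AE x in lebesgue_on S. f x = g x"
  shows borel_measurable_lebesgue_on_cong_AE:
      "f \<in> borel_measurable (lebesgue_on S) \<longleftrightarrow> g \<in> borel_measurable (lebesgue_on S)"
    and integrable_lebesgue_on_cong_AE: "integrable (lebesgue_on S) f \<longleftrightarrow> integrable (lebesgue_on S) g"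
    and integral_lebesgue_on_cong_AE:
      "integral\<^sup>L (lebesgue_on S) f = integral\<^sup>L (lebesgue_on S) g"
proof -
  have "AE x in lebesgue. (if x \<in> S then f x else 0) = (if x \<in> S then g x else 0)"
    using ae S by (auto simp: AE_restrict_space_iff elim: eventually_mono)
  then show meas: "f \<in> borel_measurable (lebesgue_on S) \<longleftrightarrow> g \<in> borel_measurable (lebesgue_on S)"
    unfolding borel_measurable_if[OF S, symmetric]
    by (auto elim: borel_measurable_AE simp: eq_commute)
  show int: "integrable (lebesgue_on S) f \<longleftrightarrow> integrable (lebesgue_on S) g"
    using integrable_cong_AE[OF _ _ ae] meas borel_measurable_integrable by blast
  show "integral\<^sup>L (lebesgue_on S) f = integral\<^sup>L (lebesgue_on S) g"
    using ae int
    by (cases "integrable (lebesgue_on S) f")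
      (auto intro!: integral_cong_AE simp: not_integrable_integral_eq)
qed

text \<open>
  A Lebesgue measurable function agrees almost everywhere with a Borel function, and clamping
  the latter to \<open>[m, M]\<close> makes the bounds hold everywhere without changing its class. Agreement is
  needed along almost every section in either direction: one for the operator, the other for the
  update.
\<close>

lemma kernel_borel_representative:
  fixes S :: "'a::euclidean_space set" and T :: "'b::euclidean_space set"
    and a :: "'a \<Rightarrow> 'b \<Rightarrow> real"
  assumes "open S" "open T" and mM: "m \<le> M"
    and meas: "(\<lambda>(s, t). a s t) \<in> borel_measurable (lebesgue_on (S \<times> T))"
    and bounds: "AE (s, t) in lebesgue_on (S \<times> T). m \<le> a s t \<and> a s t \<le> M"
  obtains b where "(\<lambda>(s, t). b s t) \<in> borel_measurable (lebesgue_on S \<Otimes>\<^sub>M lebesgue_on T)"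
    and "\<And>s t. m \<le> b s t" "\<And>s t. b s t \<le> M"
    and "AE s in lebesgue_on S. AE t in lebesgue_on T. a s t = b s t"
    and "AE t in lebesgue_on T. AE s in lebesgue_on S. a s t = b s t"
proof -
  have ST: "S \<times> T \<in> sets lebesgue"
    using open_Times[OF assms(1,2)] by (auto intro!: sets_completionI_sets)
  have "(\<lambda>p. if p \<in> S \<times> T then (case p of (s, t) \<Rightarrow> a s t) else 0) \<in> borel_measurable lebesgue"
    using meas ST by (simp only: borel_measurable_if)
  then obtain g where g: "g \<in> borel_measurable lborel"
    and ae: "AE p in lborel. (if p \<in> S \<times> T then (case p of (s, t) \<Rightarrow> a s t) else 0) = g p"
    using completion_ex_borel_measurable_real by blast
  define b where "b s t = max m (min M (g (s, t)))" for s t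
  have gb [measurable]: "g \<in> borel_measurable (borel \<Otimes>\<^sub>M borel)"
    using g by (simp add: borel_prod)
  have [measurable]: "(\<lambda>x. x) \<in> lebesgue_on S \<rightarrow>\<^sub>M borel" "(\<lambda>x. x) \<in> lebesgue_on T \<rightarrow>\<^sub>M borel"
    using id_borel_measurable_lebesgue_on unfolding id_def by auto
  have [measurable]: "fst \<in> lebesgue_on S \<Otimes>\<^sub>M lebesgue_on T \<rightarrow>\<^sub>M borel"
    "snd \<in> lebesgue_on S \<Otimes>\<^sub>M lebesgue_on T \<rightarrow>\<^sub>M borel"
    using measurable_compose[OF measurable_fst, of "\<lambda>x. x" "lebesgue_on S" borel]
      measurable_compose[OF measurable_snd, of "\<lambda>x. x" "lebesgue_on T" borel] by simp_all
  have bm: "(\<lambda>(s, t). b s t) \<in> borel_measurable (lebesgue_on S \<Otimes>\<^sub>M lebesgue_on T)"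
    unfolding b_def split_beta by measurable
  have "AE p in lebesgue_on (S \<times> T). (case p of (s, t) \<Rightarrow> a s t) = g p"
    using AE_completion[OF ae] ST by (auto simp: AE_restrict_space_iff elim: eventually_mono)
  with bounds have "AE p in lebesgue_on (S \<times> T). a (fst p) (snd p) = b (fst p) (snd p)"
    by eventually_elim (auto simp: b_def)
  note eq = AE_lebesgue_on_Times[OF assms(1,2) this]
  show thesis
    by (rule that[of b]) (use bm eq mM in \<open>auto simp: b_def\<close>)
qed

section \<open>The loping iteration\<close>

lemma prob_density_not_AE_False:
  assumes "prob_density P x"
  shows "\<not> (AE t in P. False)"
proof
  assume "AE t in P. False"
  then have "(LINT t|P. x t) = 0" by (intro integral_eq_zero_AE) (auto elim: eventually_mono)
  with assms show False by (simp add: prob_density_def)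
qed

lemma Delta_iff_prob_density: "x \<in> Delta \<Omega> \<longleftrightarrow> prob_density (lebesgue_on \<Omega>) x"
  by (auto simp: Delta_def L1_def prob_density_def)

text \<open>
  The descent of the abstract setting, transferred to the original kernel. Membership of the new
  iterate in \<open>Delta \<Omega>\<close> is what allows the next step.
\<close>

lemma loping_em_step:
  fixes \<Omega> \<Sigma> :: "(real ^ 'd) set"
    and a :: "real ^ 'd \<Rightarrow> real ^ 'd \<Rightarrow> real"
    and z x u :: "real ^ 'd \<Rightarrow> real"
  assumes \<Omega>: "open \<Omega>" "bounded \<Omega>"
    and \<Sigma>: "open \<Sigma>" "bounded \<Sigma>"
    and a_meas: "(\<lambda>(s, t). a s t) \<in> borel_measurable (lebesgue_on (\<Sigma> \<times> \<Omega>))"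
    and a_mass: "AE t in lebesgue_on \<Omega>. (LINT s|lebesgue_on \<Sigma>. a s t) = 1"
    and m: "0 < m"
    and a_bounds: "AE (s, t) in lebesgue_on (\<Sigma> \<times> \<Omega>). m \<le> a s t \<and> a s t \<le> M"
    and z: "prob_density (lebesgue_on \<Sigma>) z"
    and m1: "0 < m1" and z_bounds: "AE s in lebesgue_on \<Sigma>. m1 \<le> z s \<and> z s \<le> M1"
    and u: "integrable (lebesgue_on \<Omega>) u" "AE t in lebesgue_on \<Omega>. 0 \<le> u t"
    and y: "AE s in lebesgue_on \<Sigma>. int_op \<Omega> a u s = y s"
    and dist: "(LINT s|lebesgue_on \<Sigma>. \<bar>y s - z s\<bar>) \<le> \<delta>"
    and \<theta>: "max \<bar>ln (m1 / M)\<bar> \<bar>ln (M1 / m)\<bar> * \<delta> \<le> \<theta>"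
    and x: "x \<in> Delta \<Omega>"
    and discr: "ennreal \<theta> < KL \<Sigma> z (int_op \<Omega> a x)"
  defines "x' \<equiv> \<lambda>t. x t * (LINT s|lebesgue_on \<Sigma>. a s t * z s / int_op \<Omega> a x s)"
  shows "x' \<in> Delta \<Omega>" and "KL \<Omega> u x' \<le> KL \<Omega> u x"
proof -
  have sets: "\<Omega> \<in> sets lebesgue" "\<Sigma> \<in> sets lebesgue"
    using \<Omega> \<Sigma> by (auto intro!: sets_completionI_sets)
  have xd: "prob_density (lebesgue_on \<Omega>) x" using x by (simp add: Delta_iff_prob_density)
  \<comment> \<open>The bounds on the kernel imply \<open>m \<le> M\<close> only because the domain is not a null set, which the
      existence of densities on both factors guarantees.\<close>
  have "m \<le> M"
  proof (rule ccontr)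
    assume "\<not> m \<le> M"
    with a_bounds have "AE p in lebesgue_on (\<Sigma> \<times> \<Omega>). False"
      by (auto elim!: eventually_mono)
    then have "AE s in lebesgue_on \<Sigma>. AE t in lebesgue_on \<Omega>. False"
      by (rule AE_lebesgue_on_Times(1)[OF \<Sigma>(1) \<Omega>(1)])
    then show False
      using prob_density_not_AE_False[OF z] prob_density_not_AE_False[OF xd] by simp
  qed
  then obtain b where b: "(\<lambda>(s, t). b s t) \<in> borel_measurable (lebesgue_on \<Sigma> \<Otimes>\<^sub>M lebesgue_on \<Omega>)"
      "\<And>s t. m \<le> b s t" "\<And>s t. b s t \<le> M"
    and ab: "AE s in lebesgue_on \<Sigma>. AE t in lebesgue_on \<Omega>. a s t = b s t"
      "AE t in lebesgue_on \<Omega>. AE s in lebesgue_on \<Sigma>. a s t = b s t"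
    using kernel_borel_representative[OF \<Sigma>(1) \<Omega>(1) _ a_meas a_bounds] by blast
  have b_mass: "AE t in lebesgue_on \<Omega>. (LINT s|lebesgue_on \<Sigma>. b s t) = 1"
    using ab(2) a_mass
  proof eventually_elim
    case (elim t)
    then show ?case using integral_lebesgue_on_cong_AE[OF sets(2) elim(1)] by simp
  qed
  interpret finite_measure "lebesgue_on \<Sigma>"
    by (rule finite_measure_lebesgue_on) (rule lmeasurable_open[OF \<Sigma>(2,1)])
  interpret Q: finite_measure "lebesgue_on \<Omega>"
    by (rule finite_measure_lebesgue_on) (rule lmeasurable_open[OF \<Omega>(2,1)])
  interpret K: bounded_markov_kernel "lebesgue_on \<Sigma>" "lebesgue_on \<Omega>" b m M
    by unfold_locales (use b b_mass m in auto)
  have fwd: "AE s in lebesgue_on \<Sigma>. int_op \<Omega> a f s = K.forward f s" for f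
    using ab(1)
  proof eventually_elim
    case (elim s)
    then have "AE t in lebesgue_on \<Omega>. a s t * f t = b s t * f t"
      by (auto elim: eventually_mono)
    then show ?case
      unfolding int_op_def K.forward_def by (rule integral_lebesgue_on_cong_AE[OF sets(1)])
  qed
  have x': "AE t in lebesgue_on \<Omega>. x t * K.em_factor z x t = x' t"
    using ab(2)
  proof eventually_elim
    case (elim t)
    then have "AE s in lebesgue_on \<Sigma>. a s t * z s / int_op \<Omega> a x s = b s t * (z s / K.forward x s)"
      using fwd[of x] by eventually_elim simp
    then show ?case
      unfolding x'_def K.em_factor_def by (subst integral_lebesgue_on_cong_AE[OF sets(2)]) auto
  qed
  have KLz: "KL \<Sigma> z (int_op \<Omega> a x) = (\<integral>\<^sup>+ s. kl_integrand (z s) (K.forward x s) \<partial>lebesgue_on \<Sigma>)"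
    unfolding KL_def by (rule nn_integral_cong_AE, use fwd[of x] in eventually_elim) simp
  have KLu: "KL \<Omega> u x' = (\<integral>\<^sup>+ t. kl_integrand (u t) (x t * K.em_factor z x t) \<partial>lebesgue_on \<Omega>)"
    unfolding KL_def by (rule nn_integral_cong_AE, use x' in eventually_elim) simp
  have "AE s in lebesgue_on \<Sigma>. \<bar>K.forward u s - z s\<bar> = \<bar>y s - z s\<bar>"
    using fwd[of u] y by eventually_elim simp
  from integral_lebesgue_on_cong_AE[OF sets(2) this] dist
  have dist': "(LINT s|lebesgue_on \<Sigma>. \<bar>K.forward u s - z s\<bar>) \<le> \<delta>" by simp
  note step = K.em_step_prob_density[OF xd z m1 z_bounds]
  have "AE t in lebesgue_on \<Omega>. 0 \<le> x' t"
    using step x' unfolding prob_density_def by (auto elim: eventually_elim2)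
  then show "x' \<in> Delta \<Omega>"
    using step integrable_lebesgue_on_cong_AE[OF sets(1) x']
      integral_lebesgue_on_cong_AE[OF sets(1) x']
    by (simp add: Delta_iff_prob_density prob_density_def)
  have "ennreal (max \<bar>ln (m1 / M)\<bar> \<bar>ln (M1 / m)\<bar> * \<delta>) < KL \<Sigma> z (int_op \<Omega> a x)"
    by (rule le_less_trans[OF ennreal_leI[OF \<theta>] discr])
  from K.kl_em_step_le[OF xd z m1 z_bounds u dist' this[unfolded KLz]]
  show "KL \<Omega> u x' \<le> KL \<Omega> u x"
    unfolding KLu by (simp only: KL_def)
qed

theorem proposition4p3:
  fixes \<Omega> \<Sigma> :: "(real ^ 'd) set"
    and N :: nat
    and a :: "nat \<Rightarrow> real ^ 'd \<Rightarrow> real ^ 'd \<Rightarrow> real"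
    and y yd :: "nat \<Rightarrow> real ^ 'd \<Rightarrow> real"
    and x0 xs :: "real ^ 'd \<Rightarrow> real"
    and m M m1 M1 \<tau> \<gamma> :: real
    and \<delta> :: "nat \<Rightarrow> real"
  assumes \<Omega>: "open \<Omega>" "bounded \<Omega>"
    and \<Sigma>: "open \<Sigma>" "bounded \<Sigma>"
    and N: "N \<ge> 1"
    and a_meas: "\<And>j. j < N \<Longrightarrow> (\<lambda>(s, t). a j s t) \<in> borel_measurable (lebesgue_on (\<Sigma> \<times> \<Omega>))"
    and y_L1: "\<And>j. j < N \<Longrightarrow> y j \<in> L1 \<Sigma>"
    and x0: "x0 \<in> Delta \<Omega>"
    and A1: "\<And>j. j < N \<Longrightarrow> AE t in lebesgue_on \<Omega>. (LINT s|lebesgue_on \<Sigma>. a j s t) = 1"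
    and A2: "m > 0" "M > 0"
            "\<And>j. j < N \<Longrightarrow> AE (s, t) in lebesgue_on (\<Sigma> \<times> \<Omega>). m \<le> a j s t \<and> a j s t \<le> M"
    and A3: "\<And>j. j < N \<Longrightarrow> (LINT s|lebesgue_on \<Sigma>. y j s) = 1"
            "\<exists>M'>0. \<forall>j<N. AE s in lebesgue_on \<Sigma>. y j s \<le> M'"
    and A4: "xs \<in> L1 \<Omega>"
            "AE t in lebesgue_on \<Omega>. 0 \<le> xs t"
            "\<not> (AE t in lebesgue_on \<Omega>. xs t = 0)"
            "\<And>j. j < N \<Longrightarrow> AE s in lebesgue_on \<Sigma>. int_op \<Omega> (a j) xs s = y j s"
            "KL \<Omega> xs x0 < \<infinity>"
    and A5: "\<And>j. j < N \<Longrightarrow> yd j \<in> L1 \<Sigma>"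
            "\<And>j. j < N \<Longrightarrow> (LINT s|lebesgue_on \<Sigma>. yd j s) = 1"
    and A6: "m1 > 0" "M1 > 0"
            "\<And>j. j < N \<Longrightarrow> AE s in lebesgue_on \<Sigma>. m1 \<le> yd j s \<and> yd j s \<le> M1"
    and \<tau>: "\<tau> > 1"
    and \<gamma>: "\<gamma> = max \<bar>ln (m1 / M)\<bar> \<bar>ln (M1 / m)\<bar>"
    and \<delta>: "\<And>j. j < N \<Longrightarrow> \<delta> j > 0"
    and noise: "\<And>j. j < N \<Longrightarrow> (LINT s|lebesgue_on \<Sigma>. \<bar>y j s - yd j s\<bar>) \<le> \<delta> j"
  shows "\<forall>k. KL \<Omega> xs (loping_OSEM \<Omega> \<Sigma> N a yd (\<lambda>j. \<tau> * \<gamma> * \<delta> j) x0 (Suc k))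
           \<le> KL \<Omega> xs (loping_OSEM \<Omega> \<Sigma> N a yd (\<lambda>j. \<tau> * \<gamma> * \<delta> j) x0 k)"
proof -
  have \<gamma>0: "0 \<le> \<gamma>" unfolding \<gamma> by simp
  have step: "(\<lambda>t. x t * loping_factor \<Omega> \<Sigma> N a yd (\<lambda>j. \<tau> * \<gamma> * \<delta> j) k x t) \<in> Delta \<Omega> \<and>
      KL \<Omega> xs (\<lambda>t. x t * loping_factor \<Omega> \<Sigma> N a yd (\<lambda>j. \<tau> * \<gamma> * \<delta> j) k x t) \<le> KL \<Omega> xs x"
    if x: "x \<in> Delta \<Omega>" for x k
  proof -
    define j where "j = k mod N"
    have j: "j < N" using N by (simp add: j_def)
    show ?thesis
    proof (cases "ennreal (\<tau> * \<gamma> * \<delta> j) < KL \<Sigma> (yd j) (int_op \<Omega> (a j) x)")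
      case False
      then show ?thesis using x by (simp add: loping_factor_def flip: j_def)
    next
      case True
      have "AE s in lebesgue_on \<Sigma>. 0 \<le> yd j s"
        using A6(3)[OF j] by eventually_elim (use A6(1) in linarith)
      then have z: "prob_density (lebesgue_on \<Sigma>) (yd j)"
        using A5[OF j] by (simp add: prob_density_def L1_def)
      have "1 * (\<gamma> * \<delta> j) \<le> \<tau> * (\<gamma> * \<delta> j)"
        using \<tau> \<gamma>0 \<delta>[OF j] by (intro mult_right_mono) auto
      then have \<theta>: "max \<bar>ln (m1 / M)\<bar> \<bar>ln (M1 / m)\<bar> * \<delta> j \<le> \<tau> * \<gamma> * \<delta> j"
        by (simp add: mult.assoc flip: \<gamma>)
      have xs: "integrable (lebesgue_on \<Omega>) xs" using A4(1) by (simp add: L1_def)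
      note s = loping_em_step[OF \<Omega> \<Sigma> a_meas[OF j] A1[OF j] A2(1) A2(3)[OF j] z A6(1) A6(3)[OF j]
          xs A4(2) A4(4)[OF j] noise[OF j] \<theta> x True]
      have "loping_factor \<Omega> \<Sigma> N a yd (\<lambda>j. \<tau> * \<gamma> * \<delta> j) k x
          = (\<lambda>t. LINT s|lebesgue_on \<Sigma>. a j s t * yd j s / int_op \<Omega> (a j) x s)"
        using True by (simp add: fun_eq_iff loping_factor_def flip: j_def)
      then show ?thesis using s by simp
    qed
  qed
  have "loping_OSEM \<Omega> \<Sigma> N a yd (\<lambda>j. \<tau> * \<gamma> * \<delta> j) x0 k \<in> Delta \<Omega>" for k
    by (induction k) (use x0 step in simp_all)
  then show ?thesis using step by simp
qed

end
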